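(* Let $\mathcal{M}$ be a non-zero closed subspace of the real Hardy space $H^2_{\mathbb{R}}(\mathbb{D})$ which is nearly invariant under the backward shift $T_z^*$. Then there exist a closed $T_z^*$-invariant subspace $\mathcal{N}$ of $H^2_{\mathbb{R}}(\mathbb{D})$ and a function $g\in\mathcal{M}$, orthogonal to $\mathcal{M}\cap zH^2_{\mathbb{R}}(\mathbb{D})$ and satisfying $g(0)>0$, such that $$\mathcal{M}=g\mathcal{N}=\{gf : f\in\mathcal{N}\}.$$ Further, $\|gf\|=\|f\|$ for all $gf\in\mathcal{M}$ (with $f\in\mathcal{N}$).
   Context: $\mathbb{D}$ is the open unit disc and $H^2(\mathbb{D})$ is the Hardy space of power series $f(z)=\sum_{n\ge 0}a_nz^n$ with $a_n\in\mathbb{C}$ and $\sum|a_n|^2<\infty$, with inner product $\langle \sum a_nz^n,\sum b_nz^n\rangle=\sum a_n\overline{b_n}$. The real Hardy space $H^2_{\mathbb{R}}(\mathbb{D})$ is the set of $f\in H^2(\mathbb{D})$ all of whose coefficients $a_n$ are real; it is a real Hilbert space with the same inner product. "Subspace" of $H^2_{\mathbb{R}}(\mathbb{D})$ means closed real-linear subspace. The backward shift on $H^2_{\mathbb{R}}(\mathbb{D})$ is $(T_z^*f)(z)=\frac{f(z)-f(0)}{z}$. A subspace $\mathcal{M}$ of $H^2_{\mathbb{R}}(\mathbb{D})$ is nearly invariant under $T_z^*$ if $T_z^*f\in\mathcal{M}$ whenever $f\in\mathcal{M}$ and $f(0)=0$, i.e. $T_z^*(\mathcal{M}\cap zH^2_{\mathbb{R}}(\mathbb{D}))\subset\mathcal{M}$.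 *)

theory Defs
  imports "HOL-Analysis.Analysis" "HOL-Computational_Algebra.Formal_Power_Series"
begin

definition hardy_space :: "complex fps set" where
  "hardy_space = {f. summable (\<lambda>n. (cmod (fps_nth f n))\<^sup>2)}"

definition hardy_inner :: "complex fps \<Rightarrow> complex fps \<Rightarrow> complex" where
  "hardy_inner f g = (\<Sum>n. fps_nth f n * cnj (fps_nth g n))"

lemma summable_hardy_inner:
  assumes "f \<in> hardy_space" "g \<in> hardy_space"
  shows "summable (\<lambda>n. fps_nth f n * cnj (fps_nth g n))"
proof (rule summable_comparison_test')
  show "summable (\<lambda>n. (cmod (fps_nth f n))\<^sup>2 + (cmod (fps_nth g n))\<^sup>2)"
    using assms by (intro summable_add) (auto simp: hardy_space_def)
  show "norm (fps_nth f n * cnj (fps_nth g n)) \<le> (cmod (fps_nth f n))\<^sup>2 + (cmod (fps_nth g n))\<^sup>2"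
    for n
  proof -
    have "2 * (cmod (fps_nth f n) * cmod (fps_nth g n))
        \<le> (cmod (fps_nth f n))\<^sup>2 + (cmod (fps_nth g n))\<^sup>2"
      using sum_squares_bound[of "cmod (fps_nth f n)" "cmod (fps_nth g n)"] by (simp add: mult.assoc)
    moreover have "0 \<le> cmod (fps_nth f n) * cmod (fps_nth g n)" by simp
    ultimately show ?thesis by (simp only: norm_mult complex_mod_cnj)
  qed
qed

lemma hardy_space_0: "0 \<in> hardy_space"
  by (simp add: hardy_space_def)

lemma hardy_space_add:
  assumes "f \<in> hardy_space" "g \<in> hardy_space"
  shows "f + g \<in> hardy_space"
  unfolding hardy_space_def mem_Collect_eq
proof (rule summable_comparison_test')
  show "summable (\<lambda>n. 2 * ((cmod (fps_nth f n))\<^sup>2 + (cmod (fps_nth g n))\<^sup>2))"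
    using assms by (intro summable_mult summable_add) (auto simp: hardy_space_def)
  fix n
  have "(cmod (fps_nth (f + g) n))\<^sup>2 \<le> (cmod (fps_nth f n) + cmod (fps_nth g n))\<^sup>2"
    by (intro power_mono) (auto simp: norm_triangle_ineq)
  also have "\<dots> \<le> 2 * ((cmod (fps_nth f n))\<^sup>2 + (cmod (fps_nth g n))\<^sup>2)"
    using sum_squares_bound[of "cmod (fps_nth f n)" "cmod (fps_nth g n)"] 
    by (simp add: power2_sum)
  finally show "norm ((cmod (fps_nth (f + g) n))\<^sup>2)
      \<le> 2 * ((cmod (fps_nth f n))\<^sup>2 + (cmod (fps_nth g n))\<^sup>2)" by simp
qed

lemma hardy_space_scale:
  "f \<in> hardy_space \<Longrightarrow> fps_const c * f \<in> hardy_space"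
  by (auto simp: hardy_space_def norm_mult power_mult_distrib intro: summable_mult)

lemma hardy_space_shift:
  "f \<in> hardy_space \<Longrightarrow> fps_shift 1 f \<in> hardy_space"
  unfolding hardy_space_def using summable_ignore_initial_segment[of _ 1] by auto

lemma hardy_space_conv_radius:
  assumes "f \<in> hardy_space"
  shows "fps_conv_radius f \<ge> 1"
proof -
  have "(\<lambda>n. (cmod (fps_nth f n))\<^sup>2) \<longlonglongrightarrow> 0"
    using assms unfolding hardy_space_def mem_Collect_eq by (rule summable_LIMSEQ_zero)
  hence "(\<lambda>n. cmod (fps_nth f n)) \<longlonglongrightarrow> 0" by simp
  hence "Bseq (\<lambda>n. fps_nth f n)"
    by (intro convergent_imp_Bseq) (auto simp: tendsto_norm_zero_iff convergent_def)
  then obtain K where K: "\<And>n. cmod (fps_nth f n) \<le> K" unfolding Bseq_def by blast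
  have "summable (\<lambda>n. fps_nth f n * of_real r ^ n)" if "0 < r" "r < 1" for r
  proof (rule summable_comparison_test')
    show "summable (\<lambda>n. K * r ^ n)"
      using that by (intro summable_mult summable_geometric) auto
    show "norm (fps_nth f n * of_real r ^ n) \<le> K * r ^ n" for n
      using that K[of n] by (auto simp: norm_mult norm_power intro: mult_right_mono)
  qed
  thus ?thesis unfolding fps_conv_radius_def
    by (intro conv_radius_geI_ex)
       (auto simp: one_ereal_def norm_of_real intro!: exI[of _ "complex_of_real _"])
qed

text \<open>Multiplication of power series is pointwise multiplication of the functions on the
  unit disc, so \<^term>\<open>f * g\<close> below is the product in the analytic sense.\<close>

lemma hardy_space_eval_mult:
  assumes "f \<in> hardy_space" "g \<in> hardy_space" "cmod z < 1"
  shows "eval_fps (f * g) z = eval_fps f z * eval_fps g z"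
proof (rule eval_fps_mult)
  have "ereal (norm z) < 1" using assms by (simp add: one_ereal_def)
  thus "ereal (norm z) < fps_conv_radius f" "ereal (norm z) < fps_conv_radius g"
    using assms hardy_space_conv_radius less_le_trans by blast+
qed

text \<open>A type of its own, so that closedness, (real-linear) subspaces, orthogonality and the norm
  are those of the library class \<^class>\<open>real_inner\<close>.\<close>

typedef real_hardy = "{f \<in> hardy_space. \<forall>n. fps_nth f n \<in> \<real>}"
  morphisms series Abs_real_hardy
  by (rule exI[of _ 0]) (simp add: hardy_space_0)

setup_lifting type_definition_real_hardy

lemma series_in_hardy_space [simp]: "series f \<in> hardy_space"
  using series[of f] by simp

lemma series_coeff_real [simp]: "fps_nth (series f) n \<in> \<real>"
  using series[of f] by simp

instantiation real_hardy :: real_inner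
begin

lift_definition zero_real_hardy :: real_hardy is 0
  by (simp add: hardy_space_0)

lift_definition plus_real_hardy :: "real_hardy \<Rightarrow> real_hardy \<Rightarrow> real_hardy" is "(+)"
  by (simp add: hardy_space_add)

lift_definition scaleR_real_hardy :: "real \<Rightarrow> real_hardy \<Rightarrow> real_hardy" is
  "\<lambda>c f. fps_const (of_real c) * f"
  by (simp add: hardy_space_scale)

lift_definition uminus_real_hardy :: "real_hardy \<Rightarrow> real_hardy" is uminus
  by (simp add: hardy_space_def)

definition minus_real_hardy :: "real_hardy \<Rightarrow> real_hardy \<Rightarrow> real_hardy" where
  "f - g = f + - g" for f g :: real_hardy

text \<open>The value of \<^const>\<open>hardy_inner\<close> is real here; \<^const>\<open>Re\<close> only adjusts its type,
  see \<open>of_real_inner_real_hardy\<close> below.\<close>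

definition inner_real_hardy :: "real_hardy \<Rightarrow> real_hardy \<Rightarrow> real" where
  "inner f g = Re (hardy_inner (series f) (series g))"

definition norm_real_hardy :: "real_hardy \<Rightarrow> real" where
  "norm f = sqrt (inner f f)" for f :: real_hardy

definition dist_real_hardy :: "real_hardy \<Rightarrow> real_hardy \<Rightarrow> real" where
  "dist f g = norm (f - g)" for f g :: real_hardy

definition sgn_real_hardy :: "real_hardy \<Rightarrow> real_hardy" where
  "sgn f = inverse (norm f) *\<^sub>R f" for f :: real_hardy

definition uniformity_real_hardy :: "(real_hardy \<times> real_hardy) filter" where
  "uniformity_real_hardy = (INF e\<in>{0 <..}. principal {(f, g). dist f g < e})"

definition open_real_hardy :: "real_hardy set \<Rightarrow> bool" where
  "open_real_hardy U \<longleftrightarrow>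
    (\<forall>f\<in>U. \<forall>\<^sub>F (f', g) in uniformity. f' = f \<longrightarrow> g \<in> U)"

instance
proof
  fix f g h :: real_hardy and a b :: real and U :: "real_hardy set"
  show "f + g + h = f + (g + h)" by transfer (simp add: add.assoc)
  show "f + g = g + f" by transfer (simp add: add.commute)
  show "0 + f = f" by transfer simp
  show "- f + f = 0" by transfer simp
  show "f - g = f + - g" by (rule minus_real_hardy_def)
  show "a *\<^sub>R (f + g) = a *\<^sub>R f + a *\<^sub>R g" by transfer (simp add: algebra_simps)
  show "(a + b) *\<^sub>R f = a *\<^sub>R f + b *\<^sub>R f"
    by transfer (simp add: fps_eq_iff algebra_simps)
  show "a *\<^sub>R b *\<^sub>R f = (a * b) *\<^sub>R f"
    by transfer (simp add: fps_eq_iff algebra_simps)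
  show "1 *\<^sub>R f = f" by transfer simp
  show "sgn f = inverse (norm f) *\<^sub>R f" by (rule sgn_real_hardy_def)
  show "dist f g = norm (f - g)" by (rule dist_real_hardy_def)
  show "uniformity = (INF e\<in>{0 <..}. principal {(f::real_hardy, g). dist f g < e})"
    by (rule uniformity_real_hardy_def)
  show "open U \<longleftrightarrow> (\<forall>f\<in>U. \<forall>\<^sub>F (f', g) in uniformity. f' = f \<longrightarrow> g \<in> U)"
    by (rule open_real_hardy_def)
  show "norm f = sqrt (inner f f)" by (rule norm_real_hardy_def)
  have summ: "summable (\<lambda>n. fps_nth (series f) n * cnj (fps_nth (series g) n))" for f g
    by (rule summable_hardy_inner) simp_all
  have cnj: "cnj (fps_nth (series f) n) = fps_nth (series f) n" for f n
    using series_coeff_real Reals_cnj_iff by blast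
  show "inner f g = inner g f"
    unfolding inner_real_hardy_def hardy_inner_def by (simp add: cnj mult.commute)
  show "inner (f + g) h = inner f h + inner g h"
    unfolding inner_real_hardy_def hardy_inner_def
    by (simp add: plus_real_hardy.rep_eq distrib_right suminf_add[OF summ summ, symmetric])
  show "inner (a *\<^sub>R f) g = a * inner f g"
    unfolding inner_real_hardy_def hardy_inner_def
    by (simp add: scaleR_real_hardy.rep_eq mult.assoc suminf_mult[OF summ])
  have sq: "fps_nth (series f) n * cnj (fps_nth (series f) n)
      = of_real ((cmod (fps_nth (series f) n))\<^sup>2)" for n
    using complex_norm_square by (simp only: )
  have summ': "summable (\<lambda>n. (cmod (fps_nth (series f) n))\<^sup>2)"
    using series_in_hardy_space[of f] by (simp add: hardy_space_def)
  have ff: "inner f f = (\<Sum>n. (cmod (fps_nth (series f) n))\<^sup>2)"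
    unfolding inner_real_hardy_def hardy_inner_def sq suminf_of_real[OF summ', symmetric] by simp
  show "0 \<le> inner f f"
    unfolding ff by (intro suminf_nonneg summ') simp
  have "inner f f = 0 \<longleftrightarrow> (\<forall>n. (cmod (fps_nth (series f) n))\<^sup>2 = 0)"
    unfolding ff by (intro suminf_eq_zero_iff summ') simp
  also have "\<dots> \<longleftrightarrow> series f = series 0"
    by (simp add: fps_eq_iff zero_real_hardy.rep_eq)
  finally show "inner f f = 0 \<longleftrightarrow> f = 0"
    by (simp add: series_inject)
qed

end

lemma of_real_inner_real_hardy:
  "complex_of_real (inner f g) = hardy_inner (series f) (series g)"
proof -
  have "summable (\<lambda>n. fps_nth (series f) n * cnj (fps_nth (series g) n))"
    by (rule summable_hardy_inner) simp_all
  moreover have "Im (fps_nth (series f) n) = 0" for f n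
    using series_coeff_real[of f n] by (simp add: complex_is_Real_iff)
  ultimately have "Im (hardy_inner (series f) (series g)) = 0"
    unfolding hardy_inner_def by (subst Im_suminf) auto
  thus ?thesis
    by (simp add: inner_real_hardy_def complex_eq_iff)
qed

lemma backward_shift_series:
  "(f - fps_const (eval_fps f 0)) / fps_X = fps_shift 1 f" for f :: "complex fps"
  by (simp add: fps_eq_iff)

lift_definition backward_shift :: "real_hardy \<Rightarrow> real_hardy" is
  "\<lambda>f. (f - fps_const (eval_fps f 0)) / fps_X"
  unfolding backward_shift_series using hardy_space_shift by auto

definition z_real_hardy :: "real_hardy set" where
  "z_real_hardy = {h. \<exists>f. series h = fps_X * series f}"

definition nearly_invariant :: "real_hardy set \<Rightarrow> bool" where
  "nearly_invariant M \<longleftrightarrow>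
    (\<forall>f\<in>M. eval_fps (series f) 0 = 0 \<longrightarrow> backward_shift f \<in> M)"

end

theory Submission
  imports Defs
begin

text \<open>
  The subspace \<open>M\<close> contains a unit vector \<open>g\<close> with \<open>g(0) > 0\<close> orthogonal to the elements of \<open>M\<close> that
  vanish at \<open>0\<close>. For \<open>f\<close> in \<open>M\<close> the difference \<open>f - \<langle>f, g\<rangle> g\<close> vanishes at \<open>0\<close>, so it equals
  \<open>z R f\<close> with \<open>R f\<close> in \<open>M\<close>, and \<open>\<parallel>f\<parallel>\<^sup>2 = \<langle>f, g\<rangle>\<^sup>2 + \<parallel>R f\<parallel>\<^sup>2\<close>. Iterating, \<open>f = g q\<close> where \<open>q\<close>
  has the coefficients \<open>\<langle>R\<^sup>k f, g\<rangle>\<close>, and \<open>\<parallel>q\<parallel> \<le> \<parallel>f\<parallel>\<close>. The map from \<open>f\<close> to \<open>q\<close> carries \<open>R\<close> to the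
  backward shift, so the set \<open>N\<close> of all such \<open>q\<close> is invariant. Once the map is known to be isometric,
  \<open>N\<close> is closed because \<open>M\<close> is complete.

  The point is the isometry, that is, \<open>R\<^sup>k f \<longlonglongrightarrow> 0\<close>. Weak convergence is clear, since \<open>R\<^sup>k f\<close> is \<open>g\<close>
  times the \<open>k\<close>-th backward shift of \<open>q\<close>, but \<open>g\<close> need not be bounded. The argument below avoids
  boundary values and has two parts.

  Firstly, if \<open>q\<close> is a bounded analytic function, then \<open>R\<^sup>k f \<longlonglongrightarrow> 0\<close>
  (\<open>mult_backward_shift_tendsto_0\<close>). Multiplication by the shifts of such a \<open>q\<close> is bounded in
  quadratic mean over \<open>k < n\<close>, uniformly in \<open>n\<close> (\<open>sum_norm_mult_backward_shift_le\<close>), which permits the replacement of \<open>g\<close> by a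
  polynomial; for polynomials the claim is clear, and monotonicity of \<open>\<parallel>R\<^sup>k f\<parallel>\<close> turns the averages
  into a limit.

  Secondly, the \<open>f\<close> with bounded \<open>q\<close> are dense in \<open>M\<close>. They contain \<open>g\<close>, for which \<open>q = 1\<close>, and
  they are mapped to themselves by the adjoint of \<open>R\<close>, which an energy balance for a
  linear system with transfer function \<open>q\<close> shows (\<open>conv_bounded_quot_R_adj\<close>). The iterates of the
  adjoint at \<open>g\<close> span a dense subspace: a vector of \<open>M\<close> orthogonal to all of them has \<open>q = 0\<close>.
\<close>

section \<open>Real power series and the coefficient description of the norm\<close>

text \<open>Since all coefficients are real, elements of the space are handled as real power series; products
of series then live in the integral domain \<open>real fps\<close>, where the factor \<open>g\<close> can be cancelled.\<close>

definition real_series :: "real_hardy \<Rightarrow> real fps" where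
  "real_series f = Abs_fps (\<lambda>n. Re (fps_nth (series f) n))"

lemma of_real_real_series [simp]:
  "complex_of_real (fps_nth (real_series f) n) = fps_nth (series f) n"
  by (simp add: real_series_def of_real_Re)

lemma real_series_inject [simp]: "real_series f = real_series h \<longleftrightarrow> f = h"
proof
  assume "real_series f = real_series h"
  hence "fps_nth (series f) n = fps_nth (series h) n" for n
    by (metis of_real_real_series)
  hence "series f = series h" by (simp add: fps_eq_iff)
  thus "f = h" by (simp add: series_inject)
qed simp

lemma real_series_mult_iff:
  "series h = series g * series q \<longleftrightarrow> real_series h = real_series g * real_series q"
proof -
  have "fps_nth (series g * series q) n
      = complex_of_real (fps_nth (real_series g * real_series q) n)" for n
    by (simp add: fps_mult_nth)
  moreover have "fps_nth (series h) n = complex_of_real (fps_nth (real_series h) n)" for n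
    by simp
  ultimately show ?thesis
    unfolding fps_eq_iff by (simp only: of_real_eq_iff)
qed

lemma real_series_0 [simp]: "real_series 0 = 0"
  and real_series_add [simp]: "real_series (f + h) = real_series f + real_series h"
  and real_series_scaleR [simp]: "real_series (c *\<^sub>R f) = fps_const c * real_series f"
  and real_series_uminus [simp]: "real_series (- f) = - real_series f"
  by (simp_all add: fps_eq_iff real_series_def zero_real_hardy.rep_eq plus_real_hardy.rep_eq
      scaleR_real_hardy.rep_eq uminus_real_hardy.rep_eq)

lemma real_series_diff [simp]: "real_series (f - h) = real_series f - real_series h"
  using real_series_add[of f "- h"] by simp

lemma real_series_sum [simp]: "real_series (sum F I) = (\<Sum>i\<in>I. real_series (F i))"
  by (induction I rule: infinite_finite_induct) auto

lemma real_series_backward_shift [simp]: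
  "real_series (backward_shift f) = fps_shift 1 (real_series f)"
  by (simp add: fps_eq_iff real_series_def backward_shift.rep_eq backward_shift_series
      del: One_nat_def)

lemma ex_real_series:
  assumes "summable (\<lambda>n. (fps_nth p n)\<^sup>2)"
  shows "\<exists>f. real_series f = p"
proof -
  let ?P = "Abs_fps (\<lambda>n. complex_of_real (fps_nth p n))"
  have "series (Abs_real_hardy ?P) = ?P"
    using assms by (intro Abs_real_hardy_inverse) (simp add: hardy_space_def)
  hence "real_series (Abs_real_hardy ?P) = p"
    by (simp add: real_series_def fps_eq_iff)
  thus ?thesis by blast
qed

lemma inner_sums:
  "(\<lambda>n. fps_nth (real_series f) n * fps_nth (real_series h) n) sums inner f h"
proof -
  have "(\<lambda>n. fps_nth (series f) n * cnj (fps_nth (series h) n)) sums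
      hardy_inner (series f) (series h)"
    unfolding hardy_inner_def by (rule summable_sums, rule summable_hardy_inner) simp_all
  moreover have "fps_nth (series f) n * cnj (fps_nth (series h) n)
      = complex_of_real (fps_nth (real_series f) n * fps_nth (real_series h) n)" for n
    by (simp flip: of_real_real_series)
  ultimately have "(\<lambda>n. complex_of_real (fps_nth (real_series f) n * fps_nth (real_series h) n))
      sums complex_of_real (inner f h)"
    by (simp add: of_real_inner_real_hardy)
  thus ?thesis by (simp only: sums_of_real_iff)
qed

lemma norm_sq_sums: "(\<lambda>n. (fps_nth (real_series f) n)\<^sup>2) sums (norm f)\<^sup>2"
  unfolding power2_norm_eq_inner using inner_sums[of f f] by (simp add: power2_eq_square)

lemma sum_le_norm_sq: "finite I \<Longrightarrow> (\<Sum>n\<in>I. (fps_nth (real_series f) n)\<^sup>2) \<le> (norm f)\<^sup>2"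
  using norm_sq_sums[of f] sum_le_suminf[of "\<lambda>n. (fps_nth (real_series f) n)\<^sup>2" I]
  by (simp add: sums_iff)

lemma norm_sq_leI:
  assumes "\<And>m. (\<Sum>n<m. (fps_nth (real_series f) n)\<^sup>2) \<le> B"
  shows "(norm f)\<^sup>2 \<le> B"
  using norm_sq_sums[of f] suminf_le_const[of "\<lambda>n. (fps_nth (real_series f) n)\<^sup>2" B] assms
  by (simp add: sums_iff)

lemma abs_coeff_le_norm: "\<bar>fps_nth (real_series f) n\<bar> \<le> norm f"
  using sum_le_norm_sq[of "{n}" f] by (simp add: abs_le_square_iff[symmetric])

lemma summable_ex_real_series:
  assumes "\<And>m. (\<Sum>n<m. (fps_nth p n)\<^sup>2) \<le> B"
  shows "\<exists>f. real_series f = p"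
  by (rule ex_real_series, rule bounded_imp_summable[of _ B])
     (use assms in \<open>simp_all flip: lessThan_Suc_atMost del: sum.lessThan_Suc\<close>)

lemma tendsto_coeff:
  assumes "X \<longlonglongrightarrow> f"
  shows "(\<lambda>i. fps_nth (real_series (X i)) n) \<longlonglongrightarrow> fps_nth (real_series f) n"
proof -
  have "(\<lambda>i. norm (X i - f)) \<longlonglongrightarrow> 0"
    using assms by (simp add: LIM_zero tendsto_norm_zero)
  moreover have "norm (fps_nth (real_series (X i)) n - fps_nth (real_series f) n) \<le> norm (X i - f)"
    for i using abs_coeff_le_norm[of "X i - f" n] by simp
  ultimately have "(\<lambda>i. fps_nth (real_series (X i)) n - fps_nth (real_series f) n) \<longlonglongrightarrow> 0"
    by (rule Lim_null_comparison[OF eventuallyI, rotated])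
  thus ?thesis by (rule LIM_zero_cancel)
qed

instance real_hardy :: complete_space
proof
  fix X :: "nat \<Rightarrow> real_hardy"
  assume X: "Cauchy X"
  let ?c = "\<lambda>i n. fps_nth (real_series (X i)) n"
  have "convergent (\<lambda>i. ?c i n)" for n
  proof -
    have "Cauchy (\<lambda>i. ?c i n)"
      unfolding Cauchy_def
    proof (intro allI impI)
      fix e :: real assume "e > 0"
      then obtain K where K: "\<And>i j. i \<ge> K \<Longrightarrow> j \<ge> K \<Longrightarrow> dist (X i) (X j) < e"
        using X unfolding Cauchy_def by blast
      have "dist (?c i n) (?c j n) \<le> dist (X i) (X j)" for i j
        using abs_coeff_le_norm[of "X i - X j" n] by (simp add: dist_norm)
      thus "\<exists>K. \<forall>i\<ge>K. \<forall>j\<ge>K. dist (?c i n) (?c j n) < e"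
        using K by (meson le_less_trans)
    qed
    thus ?thesis by (simp add: Cauchy_convergent_iff)
  qed
  then obtain a where a: "\<And>n. (\<lambda>i. ?c i n) \<longlonglongrightarrow> a n"
    unfolding convergent_def by metis
  have close: "\<exists>K. \<forall>i\<ge>K. \<forall>m. (\<Sum>n<m. (?c i n - a n)\<^sup>2) \<le> e\<^sup>2" if e: "e > 0" for e
  proof -
    obtain K where K: "\<And>i j. i \<ge> K \<Longrightarrow> j \<ge> K \<Longrightarrow> dist (X i) (X j) < e"
      using X e unfolding Cauchy_def by blast
    have "(\<Sum>n<m. (?c i n - a n)\<^sup>2) \<le> e\<^sup>2" if i: "i \<ge> K" for i m
    proof (rule tendsto_upperbound)
      show "(\<lambda>j. \<Sum>n<m. (?c i n - ?c j n)\<^sup>2) \<longlonglongrightarrow> (\<Sum>n<m. (?c i n - a n)\<^sup>2)"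
        by (intro tendsto_intros a)
      have "(\<Sum>n<m. (?c i n - ?c j n)\<^sup>2) \<le> e\<^sup>2" if "j \<ge> K" for j
      proof -
        have "(\<Sum>n<m. (?c i n - ?c j n)\<^sup>2) \<le> (norm (X i - X j))\<^sup>2"
          using sum_le_norm_sq[of "{..<m}" "X i - X j"] by simp
        also have "\<dots> \<le> e\<^sup>2"
          using K[OF i that] by (intro power_mono) (auto simp: dist_norm)
        finally show ?thesis .
      qed
      thus "\<forall>\<^sub>F j in sequentially. (\<Sum>n<m. (?c i n - ?c j n)\<^sup>2) \<le> e\<^sup>2"
        by (auto simp: eventually_sequentially)
    qed simp
    thus ?thesis by blast
  qed
  \<comment> \<open>a single term whose difference from the coefficientwise limit is square summable puts the limit into the space\<close>
  obtain K1 where K1: "\<And>m. (\<Sum>n<m. (?c K1 n - a n)\<^sup>2) \<le> 1"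
    using close[of 1] by auto
  then obtain d where d: "real_series d = real_series (X K1) - Abs_fps a"
    using summable_ex_real_series[of "real_series (X K1) - Abs_fps a" 1] by auto
  have A: "real_series (X K1 - d) = Abs_fps a" by (simp add: d)
  have "X \<longlonglongrightarrow> X K1 - d"
  proof (rule metric_LIMSEQ_I)
    fix e :: real assume "e > 0"
    then obtain K where K: "\<And>i m. i \<ge> K \<Longrightarrow> (\<Sum>n<m. (?c i n - a n)\<^sup>2) \<le> (e/2)\<^sup>2"
      using close[of "e/2"] by auto
    have "dist (X i) (X K1 - d) < e" if "i \<ge> K" for i
    proof -
      have "(norm (X i - (X K1 - d)))\<^sup>2 \<le> (e/2)\<^sup>2"
        using K[OF that] by (intro norm_sq_leI) (simp only: real_series_diff[of "X i"] A fps_sub_nth fps_nth_Abs_fps)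
      hence "norm (X i - (X K1 - d)) \<le> e/2"
        using \<open>e > 0\<close> by (simp add: power_mono_iff del: power_divide)
      thus ?thesis using \<open>e > 0\<close> by (simp add: dist_norm)
    qed
    thus "\<exists>K. \<forall>i\<ge>K. dist (X i) (X K1 - d) < e" by blast
  qed
  thus "convergent X" by (auto simp: convergent_def)
qed

section \<open>Orthogonal projection onto closed subspaces\<close>

text \<open>A minimising sequence for the distance from \<open>x\<close> to \<open>S\<close> is Cauchy by the parallelogram law, and its
limit \<open>p\<close> is a closest point. Moving from \<open>p\<close> by the multiple \<open>t\<close> of \<open>s\<close> that removes the component of
\<open>x - p\<close> along \<open>s\<close> cannot get closer to \<open>x\<close>, so that component vanishes.\<close>

lemma ex_orthogonal_projection:
  fixes S :: "'a::{real_inner,complete_space} set"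
  assumes S: "subspace S" "closed S"
  shows "\<exists>p\<in>S. \<forall>s\<in>S. inner (x - p) s = 0"
proof -
  define d where "d = infdist x S"
  have ne: "S \<noteq> {}" using S(1) subspace_0 by blast
  have d0: "d \<ge> 0" by (simp add: d_def infdist_nonneg)
  have d_le: "d \<le> norm (x - s)" if "s \<in> S" for s
    using infdist_le[OF that, of x] by (simp add: d_def dist_norm)
  have "\<exists>y\<in>S. (norm (x - y))\<^sup>2 < d\<^sup>2 + e" if "e > 0" for e
  proof -
    have "d < sqrt (d\<^sup>2 + e)" by (rule real_less_rsqrt) (use that in simp)
    moreover have "bdd_below (dist x ` S)" by (rule bdd_belowI2[of _ 0]) simp
    ultimately obtain y where y: "y \<in> S" "norm (x - y) < sqrt (d\<^sup>2 + e)"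
      using ne cINF_less_iff[of S "dist x"] by (auto simp: d_def infdist_def simp flip: dist_norm)
    have "(norm (x - y))\<^sup>2 < (sqrt (d\<^sup>2 + e))\<^sup>2"
      using y(2) by (intro power_strict_mono) auto
    thus ?thesis using that y(1) by (intro bexI[of _ y]) auto
  qed
  hence "\<forall>n. \<exists>y\<in>S. (norm (x - y))\<^sup>2 < d\<^sup>2 + 1 / (real n + 1)" by simp
  then obtain Y where Y: "\<And>n. Y n \<in> S" "\<And>n. (norm (x - Y n))\<^sup>2 < d\<^sup>2 + 1 / (real n + 1)"
    by metis
  \<comment> \<open>parallelogram law: the midpoint of two almost minimisers is no closer to \<open>x\<close> than \<open>d\<close>\<close>
  have YY: "(norm (Y m - Y n))\<^sup>2 \<le> 2 / (real m + 1) + 2 / (real n + 1)" for m n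
  proof -
    have "(1/2) *\<^sub>R (Y m + Y n) \<in> S"
      using S(1) Y(1) by (intro subspace_scale subspace_add)
    hence "d\<^sup>2 \<le> (norm (x - (1/2) *\<^sub>R (Y m + Y n)))\<^sup>2"
      using d_le d0 by (intro power_mono) auto
    moreover have "(norm (Y m - Y n))\<^sup>2 + 4 * (norm (x - (1/2) *\<^sub>R (Y m + Y n)))\<^sup>2
        = 2 * (norm (x - Y m))\<^sup>2 + 2 * (norm (x - Y n))\<^sup>2"
    proof -
      have par: "(norm (b - a))\<^sup>2 + 4 * (norm ((1/2) *\<^sub>R (a + b)))\<^sup>2 = 2 * (norm a)\<^sup>2 + 2 * (norm b)\<^sup>2"
        for a b :: 'a
        by (simp add: power_divide)
           (simp add: power2_norm_eq_inner inner_diff inner_add)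
      have "(1/2) *\<^sub>R ((x - Y m) + (x - Y n)) = x - (1/2) *\<^sub>R (Y m + Y n)"
        by (simp add: scaleR_right_distrib scaleR_right_diff_distrib flip: scaleR_left_distrib)
      thus ?thesis using par[where a = "x - Y m" and b = "x - Y n"] by simp
    qed
    ultimately show ?thesis using Y(2)[of m] Y(2)[of n] by simp
  qed
  have "Cauchy Y"
    unfolding Cauchy_def
  proof (intro allI impI)
    fix e :: real assume e: "e > 0"
    then obtain K :: nat where K: "4 / e\<^sup>2 < real K" using reals_Archimedean2 by blast
    have "dist (Y m) (Y n) < e" if "m \<ge> K" "n \<ge> K" for m n
    proof -
      have K': "2 / (real i + 1) < e\<^sup>2 / 2" if "i \<ge> K" for i
      proof -
        have "4 < e\<^sup>2 * real K" using K e by (simp add: field_simps)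
        also have "\<dots> \<le> e\<^sup>2 * (real i + 1)" using that by (intro mult_left_mono) auto
        finally show ?thesis by (simp add: field_simps)
      qed
      have "(norm (Y m - Y n))\<^sup>2 < e\<^sup>2" using YY[of m n] K'[OF that(1)] K'[OF that(2)] by simp
      thus ?thesis using e by (simp add: dist_norm power_less_imp_less_base)
    qed
    thus "\<exists>K. \<forall>m\<ge>K. \<forall>n\<ge>K. dist (Y m) (Y n) < e" by blast
  qed
  then obtain p where p: "Y \<longlonglongrightarrow> p" by (auto simp: Cauchy_convergent_iff convergent_def)
  have pS: "p \<in> S" using closed_sequentially[OF S(2)] Y(1) p by blast
  have "(norm (x - p))\<^sup>2 \<le> d\<^sup>2"
  proof (rule LIMSEQ_le)
    show "(\<lambda>n. (norm (x - Y n))\<^sup>2) \<longlonglongrightarrow> (norm (x - p))\<^sup>2" by (intro tendsto_intros p)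
    have "(\<lambda>n. d\<^sup>2 + 1 / (real n + 1)) \<longlonglongrightarrow> d\<^sup>2 + 0"
      using LIMSEQ_inverse_real_of_nat
      by (intro tendsto_intros) (simp add: inverse_eq_divide add.commute)
    thus "(\<lambda>n. d\<^sup>2 + 1 / (real n + 1)) \<longlonglongrightarrow> d\<^sup>2" by simp
    show "\<exists>N. \<forall>n\<ge>N. (norm (x - Y n))\<^sup>2 \<le> d\<^sup>2 + 1 / (real n + 1)"
      using Y(2) by (intro exI allI impI less_imp_le)
  qed
  hence min: "(norm (x - p))\<^sup>2 \<le> (norm (x - s))\<^sup>2" if "s \<in> S" for s
    using power_mono[OF d_le[OF that] d0, of 2] by linarith
  have "inner (x - p) s = 0" if s: "s \<in> S" for s
  proof (cases "s = 0")
    case False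
    define t where "t = inner (x - p) s / (norm s)\<^sup>2"
    have "p + t *\<^sub>R s \<in> S" using S(1) pS s by (intro subspace_add subspace_scale)
    from min[OF this] have "(norm (x - p))\<^sup>2 \<le> (norm ((x - p) - t *\<^sub>R s))\<^sup>2"
      by (simp add: diff_diff_add)
    also have "\<dots> = (norm (x - p))\<^sup>2 - 2 * t * inner (x - p) s + t\<^sup>2 * (norm s)\<^sup>2"
    proof -
      have "(norm (a - t *\<^sub>R s))\<^sup>2 = (norm a)\<^sup>2 - 2 * t * inner a s + t\<^sup>2 * (norm s)\<^sup>2" for a
        unfolding power2_norm_eq_inner
        by (simp add: inner_diff inner_commute algebra_simps power2_eq_square)
      thus ?thesis .
    qed
    also have "\<dots> = (norm (x - p))\<^sup>2 - (inner (x - p) s)\<^sup>2 / (norm s)\<^sup>2"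
      using False by (simp add: t_def field_simps power2_eq_square)
    finally have "(inner (x - p) s)\<^sup>2 / (norm s)\<^sup>2 \<le> 0" by simp
    thus ?thesis using False by (simp add: divide_le_0_iff)
  qed simp
  thus ?thesis using pS by blast
qed

section \<open>The two shifts\<close>

lemma ex_forward_shift: "\<exists>h. real_series h = fps_X * real_series f"
proof (rule ex_real_series)
  have "summable (\<lambda>n. (fps_nth (real_series f) n)\<^sup>2)"
    using norm_sq_sums by (auto simp: sums_iff)
  thus "summable (\<lambda>n. (fps_nth (fps_X * real_series f) n)\<^sup>2)"
    by (subst summable_Suc_iff[symmetric]) simp
qed

definition forward_shift :: "real_hardy \<Rightarrow> real_hardy" where
  "forward_shift f = (SOME h. real_series h = fps_X * real_series f)"

lemma real_series_forward_shift [simp]: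
  "real_series (forward_shift f) = fps_X * real_series f"
  unfolding forward_shift_def by (rule someI_ex[OF ex_forward_shift])

lemma inner_forward_shift [simp]: "inner (forward_shift f) (forward_shift h) = inner f h"
proof -
  let ?t = "\<lambda>n. fps_nth (real_series (forward_shift f)) n * fps_nth (real_series (forward_shift h)) n"
  have "(\<lambda>n. ?t (Suc n)) sums inner f h" using inner_sums[of f h] by simp
  hence "?t sums (inner f h + ?t 0)" by (rule sums_Suc)
  thus ?thesis using inner_sums[of "forward_shift f" "forward_shift h"] sums_unique2 by fastforce
qed

lemma norm_forward_shift [simp]: "norm (forward_shift f) = norm f"
  by (simp add: norm_eq_sqrt_inner)

lemma forward_shift_backward_shift:
  assumes "fps_nth (real_series f) 0 = 0"
  shows "forward_shift (backward_shift f) = f"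
proof -
  have "fps_X * fps_shift 1 (real_series f) = real_series f"
    using assms by (auto simp: fps_eq_iff gr0_conv_Suc)
  thus ?thesis by (simp flip: real_series_inject)
qed

lemma real_series_funpow_forward_shift [simp]:
  "real_series ((forward_shift ^^ k) f) = fps_X ^ k * real_series f"
  by (induction k) (auto simp: mult.assoc)

lemma norm_funpow_forward_shift [simp]: "norm ((forward_shift ^^ k) f) = norm f"
  by (induction k) auto

lemma real_series_funpow_backward_shift [simp]:
  "real_series ((backward_shift ^^ k) f) = fps_shift k (real_series f)"
  by (induction k) (auto simp: fps_eq_iff)

lemma norm_backward_shift_sq_sums:
  "(\<lambda>n. (fps_nth (real_series f) (n + k))\<^sup>2) sums (norm ((backward_shift ^^ k) f))\<^sup>2"
  using norm_sq_sums[of "(backward_shift ^^ k) f"] by simp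

lemma norm_backward_shift_sq_eq:
  "(norm ((backward_shift ^^ k) f))\<^sup>2 = (norm f)\<^sup>2 - (\<Sum>n<k. (fps_nth (real_series f) n)\<^sup>2)"
  using sums_split_initial_segment[OF norm_sq_sums[of f], of k]
    norm_backward_shift_sq_sums[of f k] by (rule sums_unique2[symmetric])

lemma norm_backward_shift_mono:
  assumes "j \<le> k"
  shows "(norm ((backward_shift ^^ k) f))\<^sup>2 \<le> (norm ((backward_shift ^^ j) f))\<^sup>2"
  unfolding norm_backward_shift_sq_eq using assms
  by (intro diff_left_mono sum_mono2) auto

lemma norm_backward_shift_tendsto_0:
  "(\<lambda>k. (norm ((backward_shift ^^ k) f))\<^sup>2) \<longlonglongrightarrow> 0"
proof -
  have "(\<lambda>k. (norm f)\<^sup>2 - (\<Sum>n<k. (fps_nth (real_series f) n)\<^sup>2)) \<longlonglongrightarrow> (norm f)\<^sup>2 - (norm f)\<^sup>2"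
    using norm_sq_sums[of f] by (intro tendsto_intros) (simp add: sums_def)
  thus ?thesis by (simp add: norm_backward_shift_sq_eq)
qed

lemma z_real_hardy_iff: "h \<in> z_real_hardy \<longleftrightarrow> fps_nth (real_series h) 0 = 0"
proof
  assume "h \<in> z_real_hardy"
  thus "fps_nth (real_series h) 0 = 0" by (auto simp: z_real_hardy_def real_series_def)
next
  assume "fps_nth (real_series h) 0 = 0"
  hence "fps_nth (series h) 0 = 0" using of_real_real_series[of h 0] by simp
  hence "series h = fps_X * series (backward_shift h)"
    by (auto simp: fps_eq_iff backward_shift.rep_eq backward_shift_series gr0_conv_Suc)
  thus "h \<in> z_real_hardy" by (auto simp: z_real_hardy_def)
qed

lemma eval_fps_series_0: "eval_fps (series f) 0 = complex_of_real (fps_nth (real_series f) 0)"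
  by (simp add: eval_fps_at_0)

lemma nearly_invariantD:
  assumes "nearly_invariant M" "f \<in> M" "fps_nth (real_series f) 0 = 0"
  shows "backward_shift f \<in> M"
  using assms unfolding nearly_invariant_def eval_fps_series_0 by (simp del: of_real_real_series)

section \<open>Multipliers and Cesaro means\<close>

text \<open>The condition says that every finite section of the lower triangular Toeplitz matrix of \<open>q\<close> has
squared norm at most \<open>B\<close>; it is the coefficient form of \<open>q\<close> being a bounded analytic function with
\<open>\<bar>q\<bar>\<^sup>2 \<le> B\<close> on the disc.\<close>

definition conv_bounded :: "real \<Rightarrow> real fps \<Rightarrow> bool" where
  "conv_bounded B q \<longleftrightarrow>
    (\<forall>h N. (\<Sum>k<N. (fps_nth (q * h) k)\<^sup>2) \<le> B * (\<Sum>k<N. (fps_nth h k)\<^sup>2))"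

lemma conv_boundedD:
  "conv_bounded B q \<Longrightarrow> (\<Sum>k<N. (fps_nth (q * h) k)\<^sup>2) \<le> B * (\<Sum>k<N. (fps_nth h k)\<^sup>2)"
  by (simp add: conv_bounded_def)

lemma conv_bounded_nonneg:
  assumes "conv_bounded B q"
  shows "B \<ge> 0"
  using conv_boundedD[OF assms, where h = 1 and N = 1] by (auto intro: order_trans[rotated])

text \<open>Coefficient \<open>d\<close> of \<open>g\<close> times the shifted \<open>q\<close> is the part of the convolution of \<open>q\<close> and \<open>g\<close> at
\<open>Suc k + d\<close> in which the index of \<open>q\<close> exceeds \<open>k\<close>. The complementary part is again a convolution
with \<open>q\<close>, now of a shift of \<open>g\<close>, and is read off at position \<open>k\<close>. For fixed \<open>d\<close> its values are
therefore controlled, as \<open>k\<close> varies, by boundedness of \<open>q\<close>.\<close>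

lemma fps_mult_shift_nth:
  fixes g q :: "real fps"
  shows "fps_nth (g * fps_shift (Suc k) q) d
    = fps_nth (q * g) (Suc k + d) - fps_nth (q * fps_shift (Suc d) g) k"
proof -
  let ?t = "\<lambda>i. fps_nth q i * fps_nth g (Suc k + d - i)"
  have "fps_nth (q * g) (Suc k + d) = (\<Sum>i\<le>k. ?t i) + (\<Sum>i\<in>{Suc k..Suc k + d}. ?t i)"
  proof -
    have "{0..Suc k + d} = {..k} \<union> {Suc k..Suc k + d}" by auto
    thus ?thesis unfolding fps_mult_nth by (simp only:) (rule sum.union_disjoint; auto)
  qed
  also have "(\<Sum>i\<le>k. ?t i) = fps_nth (q * fps_shift (Suc d) g) k"
    unfolding fps_mult_nth atMost_atLeast0
    by (intro sum.cong) (auto simp: Suc_diff_le trans_le_add2 add.commute)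
  also have "(\<Sum>i\<in>{Suc k..Suc k + d}. ?t i) = (\<Sum>i\<le>d. ?t (Suc k + i))"
    using sum.shift_bounds_cl_nat_ivl[of ?t 0 "Suc k" d]
    by (simp add: atMost_atLeast0 add.commute)
  also have "\<dots> = fps_nth (fps_shift (Suc k) q * g) d"
    unfolding fps_mult_nth atMost_atLeast0 by (intro sum.cong) (auto simp: add.commute)
  finally show ?thesis by (simp add: mult.commute)
qed

lemma power2_diff_le: "((a::real) - b)\<^sup>2 \<le> 2 * a\<^sup>2 + 2 * b\<^sup>2"
  using zero_le_power2[of "a + b"] by (simp add: power2_eq_square algebra_simps)

lemma norm_add_sq_le:
  fixes a b :: "'a::real_inner"
  shows "(norm (a + b))\<^sup>2 \<le> 2 * (norm a)\<^sup>2 + 2 * (norm b)\<^sup>2"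
  using zero_le_power2[of "norm (a - b)"]
  by (simp add: power2_norm_eq_inner inner_diff inner_add inner_commute)

text \<open>A mean over \<open>k\<close> of the squared norms of \<open>g\<close> times the \<open>k\<close>-th shift of \<open>q\<close> is controlled by the norm
of \<open>g\<close> alone. The individual terms need not admit a bound independent of \<open>k\<close>, because the partial
sums of a bounded \<open>q\<close> need not be uniformly bounded on the disc. Averaging helps since the
convolutions in the preceding lemma can be summed over \<open>k\<close> for each fixed \<open>d\<close>.\<close>

lemma sum_norm_mult_backward_shift_le:
  assumes q: "conv_bounded B q"
    and u: "\<And>k. real_series (u k) = real_series g * fps_shift k q"
  shows "(\<Sum>k<N. (norm (u (Suc k)))\<^sup>2) \<le> 4 * B * real N * (norm g)\<^sup>2"
proof (rule tendsto_upperbound)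
  let ?g = "real_series g"
  have B: "B \<ge> 0" by (rule conv_bounded_nonneg[OF q])
  show "(\<lambda>m. \<Sum>k<N. \<Sum>d<m. (fps_nth (real_series (u (Suc k))) d)\<^sup>2)
      \<longlonglongrightarrow> (\<Sum>k<N. (norm (u (Suc k)))\<^sup>2)"
    using norm_sq_sums by (intro tendsto_sum) (simp add: sums_def)
  have "(\<Sum>k<N. \<Sum>d<m. (fps_nth (real_series (u (Suc k))) d)\<^sup>2) \<le> 4 * B * real N * (norm g)\<^sup>2"
    for m
  proof -
    have le_norm: "(\<Sum>n\<in>I. (fps_nth ?g n)\<^sup>2) \<le> (norm g)\<^sup>2" if "finite I" for I
      using that by (rule sum_le_norm_sq)
    have first: "(\<Sum>d<m. (fps_nth (q * ?g) (Suc k + d))\<^sup>2) \<le> B * (norm g)\<^sup>2" for k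
    proof -
      have "(\<Sum>d<m. (fps_nth (q * ?g) (Suc k + d))\<^sup>2)
          = (\<Sum>n\<in>(+) (Suc k) ` {..<m}. (fps_nth (q * ?g) n)\<^sup>2)"
        by (subst sum.reindex) (auto simp: inj_on_def)
      also have "\<dots> \<le> (\<Sum>n<Suc k + m. (fps_nth (q * ?g) n)\<^sup>2)"
        by (intro sum_mono2) auto
      also have "\<dots> \<le> B * (\<Sum>n<Suc k + m. (fps_nth ?g n)\<^sup>2)"
        by (rule conv_boundedD[OF q])
      also have "\<dots> \<le> B * (norm g)\<^sup>2"
        using B by (intro mult_left_mono le_norm) auto
      finally show ?thesis .
    qed
    have "(\<Sum>k<N. \<Sum>d<m. (fps_nth (q * fps_shift (Suc d) ?g) k)\<^sup>2)
        = (\<Sum>d<m. \<Sum>k<N. (fps_nth (q * fps_shift (Suc d) ?g) k)\<^sup>2)"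
      by (rule sum.swap)
    also have "\<dots> \<le> (\<Sum>d<m. B * (\<Sum>j<N. (fps_nth (fps_shift (Suc d) ?g) j)\<^sup>2))"
      by (intro sum_mono conv_boundedD[OF q])
    also have "\<dots> = B * (\<Sum>j<N. \<Sum>d<m. (fps_nth ?g (j + Suc d))\<^sup>2)"
      by (simp add: sum_distrib_left sum.swap[of _ "{..<N}" "{..<m}"])
    also have "\<dots> \<le> B * (\<Sum>j<N. (norm g)\<^sup>2)"
    proof (intro mult_left_mono sum_mono B)
      fix j
      have "(\<Sum>d<m. (fps_nth ?g (j + Suc d))\<^sup>2)
          = (\<Sum>n\<in>(\<lambda>d. j + Suc d) ` {..<m}. (fps_nth ?g n)\<^sup>2)"
        by (subst sum.reindex) (auto simp: inj_on_def)
      also have "\<dots> \<le> (norm g)\<^sup>2" by (intro le_norm) simp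
      finally show "(\<Sum>d<m. (fps_nth ?g (j + Suc d))\<^sup>2) \<le> (norm g)\<^sup>2" .
    qed
    finally have second: "(\<Sum>k<N. \<Sum>d<m. (fps_nth (q * fps_shift (Suc d) ?g) k)\<^sup>2)
        \<le> B * (real N * (norm g)\<^sup>2)" by simp
    have "(\<Sum>k<N. \<Sum>d<m. (fps_nth (real_series (u (Suc k))) d)\<^sup>2)
        \<le> (\<Sum>k<N. \<Sum>d<m. 2 * (fps_nth (q * ?g) (Suc k + d))\<^sup>2
            + 2 * (fps_nth (q * fps_shift (Suc d) ?g) k)\<^sup>2)"
      unfolding u fps_mult_shift_nth[of ?g _ q] by (intro sum_mono power2_diff_le)
    also have "\<dots> = 2 * (\<Sum>k<N. \<Sum>d<m. (fps_nth (q * ?g) (Suc k + d))\<^sup>2)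
        + 2 * (\<Sum>k<N. \<Sum>d<m. (fps_nth (q * fps_shift (Suc d) ?g) k)\<^sup>2)"
      by (simp only: sum.distrib sum_distrib_left)
    also have "\<dots> \<le> 2 * (\<Sum>k<N. B * (norm g)\<^sup>2) + 2 * (B * (real N * (norm g)\<^sup>2))"
      by (intro add_mono mult_left_mono sum_mono first second) auto
    also have "\<dots> = 4 * B * real N * (norm g)\<^sup>2" by simp
    finally show ?thesis .
  qed
  thus "\<forall>\<^sub>F m in sequentially.
      (\<Sum>k<N. \<Sum>d<m. (fps_nth (real_series (u (Suc k))) d)\<^sup>2) \<le> 4 * B * real N * (norm g)\<^sup>2"
    by simp
qed simp

text \<open>Multiplication by the Taylor polynomial of \<open>g\<close> with \<open>D\<close> terms, written with shifts so that the result
visibly lies in the space.\<close>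

definition mult_cutoff :: "nat \<Rightarrow> real_hardy \<Rightarrow> real_hardy \<Rightarrow> real_hardy" where
  "mult_cutoff D g f = (\<Sum>i<D. fps_nth (real_series g) i *\<^sub>R (forward_shift ^^ i) f)"

lemma real_series_mult_cutoff:
  "real_series (mult_cutoff D g f) = fps_cutoff D (real_series g) * real_series f"
proof -
  have "fps_cutoff D (real_series g) = (\<Sum>i<D. fps_const (fps_nth (real_series g) i) * fps_X ^ i)"
    by (auto simp: fps_eq_iff fps_sum_nth fps_X_power_nth if_distrib cong: if_cong)
  thus ?thesis by (simp add: mult_cutoff_def sum_distrib_right mult.assoc)
qed

lemma norm_mult_cutoff_le:
  "norm (mult_cutoff D g f) \<le> (\<Sum>i<D. \<bar>fps_nth (real_series g) i\<bar>) * norm f"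
  unfolding mult_cutoff_def sum_distrib_right by (rule sum_norm_le) simp

text \<open>If \<open>g\<close> were a polynomial, multiplication by \<open>g\<close> would be bounded and the claim would follow from the
convergence to \<open>0\<close> of the shifts of \<open>q\<close>. In general \<open>g\<close> is split into a Taylor polynomial and a tail
of small norm; the tail contributes little on average over \<open>k\<close> by the preceding bound, and since the norms
of \<open>u\<close> decrease, a small average forces a small last term.\<close>

lemma mult_backward_shift_tendsto_0:
  assumes q: "conv_bounded B (real_series q)"
    and u: "\<And>k. real_series (u k) = real_series g * fps_shift k (real_series q)"
    and mono: "\<And>k. norm (u (Suc k)) \<le> norm (u k)"
  shows "u \<longlonglongrightarrow> 0"
proof -
  have B: "B \<ge> 0" by (rule conv_bounded_nonneg[OF q])
  have decr: "(norm (u j))\<^sup>2 \<le> (norm (u i))\<^sup>2" if "i \<le> j" for i j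
    using lift_Suc_antimono_le[of "\<lambda>k. norm (u k)", OF mono that] by (intro power_mono) auto
  define K where "K D = (\<Sum>i<D. \<bar>fps_nth (real_series g) i\<bar>)" for D
  let ?T = "\<lambda>k f. (norm ((backward_shift ^^ k) f))\<^sup>2"
  have bound: "(norm (u (2 * k)))\<^sup>2 \<le> 2 * (K D)\<^sup>2 * ?T k q + 16 * B * ?T D g" if k: "k > 0" for k D
  proof -
    define g' where "g' = (forward_shift ^^ D) ((backward_shift ^^ D) g)"
    have g': "real_series g' = real_series g - fps_cutoff D (real_series g)"
      unfolding g'_def by (auto simp: fps_eq_iff fps_X_power_mult_nth)
    define w where "w j = mult_cutoff D g ((backward_shift ^^ j) q)" for j
    have uw: "real_series (u j - w j) = real_series g' * fps_shift j (real_series q)" for j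
      by (simp add: w_def u real_series_mult_cutoff g' algebra_simps)
    have w: "(norm (w (Suc j)))\<^sup>2 \<le> (K D)\<^sup>2 * ?T k q" if "k \<le> j" for j
    proof -
      have "(norm (w (Suc j)))\<^sup>2 \<le> (K D * norm ((backward_shift ^^ Suc j) q))\<^sup>2"
        unfolding w_def K_def by (intro power_mono norm_mult_cutoff_le) auto
      also have "\<dots> = (K D)\<^sup>2 * ?T (Suc j) q" by (rule power_mult_distrib)
      also have "\<dots> \<le> (K D)\<^sup>2 * ?T k q"
        using that by (intro mult_left_mono norm_backward_shift_mono) auto
      finally show ?thesis .
    qed
    \<comment> \<open>average over the second half of the indices up to \<open>2 * k\<close>: there the shifts of \<open>q\<close> are already small\<close>
    have "real k * (norm (u (2 * k)))\<^sup>2 = (\<Sum>j\<in>{k..<2*k}. (norm (u (2 * k)))\<^sup>2)" by simp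
    also have "\<dots> \<le> (\<Sum>j\<in>{k..<2*k}. 2 * (norm (w (Suc j)))\<^sup>2 + 2 * (norm (u (Suc j) - w (Suc j)))\<^sup>2)"
    proof (intro sum_mono)
      fix j assume "j \<in> {k..<2*k}"
      hence "(norm (u (2 * k)))\<^sup>2 \<le> (norm (w (Suc j) + (u (Suc j) - w (Suc j))))\<^sup>2"
        using decr[of "Suc j" "2 * k"] by simp
      also have "\<dots> \<le> 2 * (norm (w (Suc j)))\<^sup>2 + 2 * (norm (u (Suc j) - w (Suc j)))\<^sup>2"
        by (rule norm_add_sq_le)
      finally show "(norm (u (2 * k)))\<^sup>2
          \<le> 2 * (norm (w (Suc j)))\<^sup>2 + 2 * (norm (u (Suc j) - w (Suc j)))\<^sup>2" .
    qed
    also have "\<dots> = 2 * (\<Sum>j\<in>{k..<2*k}. (norm (w (Suc j)))\<^sup>2)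
        + 2 * (\<Sum>j\<in>{k..<2*k}. (norm (u (Suc j) - w (Suc j)))\<^sup>2)"
      by (simp only: sum.distrib sum_distrib_left)
    also have "\<dots> \<le> 2 * (\<Sum>j\<in>{k..<2*k}. (K D)\<^sup>2 * ?T k q) + 2 * (4 * B * real (2 * k) * (norm g')\<^sup>2)"
    proof (intro add_mono mult_left_mono)
      show "(\<Sum>j\<in>{k..<2*k}. (norm (w (Suc j)))\<^sup>2) \<le> (\<Sum>j\<in>{k..<2*k}. (K D)\<^sup>2 * ?T k q)"
        by (intro sum_mono w) simp
      have "(\<Sum>j\<in>{k..<2*k}. (norm (u (Suc j) - w (Suc j)))\<^sup>2)
          \<le> (\<Sum>j<2*k. (norm (u (Suc j) - w (Suc j)))\<^sup>2)"
        by (intro sum_mono2) auto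
      also have "\<dots> \<le> 4 * B * real (2 * k) * (norm g')\<^sup>2"
        by (rule sum_norm_mult_backward_shift_le[OF q uw])
      finally show "(\<Sum>j\<in>{k..<2*k}. (norm (u (Suc j) - w (Suc j)))\<^sup>2)
          \<le> 4 * B * real (2 * k) * (norm g')\<^sup>2" .
    qed auto
    also have "\<dots> = real k * (2 * (K D)\<^sup>2 * ?T k q + 16 * B * ?T D g)"
      by (simp add: g'_def algebra_simps)
    finally show ?thesis using k by (simp only: mult_le_cancel_left_pos of_nat_0_less_iff)
  qed
  have "(\<lambda>k. (norm (u k))\<^sup>2) \<longlonglongrightarrow> 0"
  proof (rule LIMSEQ_I)
    fix e :: real assume e: "e > 0"
    have "(\<lambda>D. 16 * B * ?T D g) \<longlonglongrightarrow> 16 * B * 0"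
      by (intro tendsto_intros norm_backward_shift_tendsto_0)
    hence "\<forall>\<^sub>F D in sequentially. 16 * B * ?T D g < e / 2"
      using e by (intro order_tendstoD(2)) auto
    then obtain D where D: "16 * B * ?T D g < e / 2"
      by (auto simp: eventually_sequentially)
    have "(\<lambda>k. 2 * (K D)\<^sup>2 * ?T k q) \<longlonglongrightarrow> 2 * (K D)\<^sup>2 * 0"
      by (intro tendsto_intros norm_backward_shift_tendsto_0)
    hence "\<forall>\<^sub>F k in sequentially. 2 * (K D)\<^sup>2 * ?T k q < e / 2"
      using e by (intro order_tendstoD(2)) auto
    then obtain k where k: "\<And>j. j \<ge> k \<Longrightarrow> 2 * (K D)\<^sup>2 * ?T j q < e / 2"
      by (auto simp: eventually_sequentially)
    have "(norm (u n))\<^sup>2 < e" if "n \<ge> 2 * Suc k" for n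
      using decr[OF that] bound[of "Suc k" D] k[of "Suc k"] D by linarith
    thus "\<exists>no. \<forall>n\<ge>no. norm ((norm (u n))\<^sup>2 - 0) < e" by auto
  qed
  hence "(\<lambda>k. norm (u k)) \<longlonglongrightarrow> 0" by simp
  thus ?thesis by (rule tendsto_norm_zero_cancel)
qed

section \<open>The compressed shift of a nearly invariant subspace\<close>

lemma backward_shift_add: "backward_shift (f + h) = backward_shift f + backward_shift h"
  and backward_shift_scaleR: "backward_shift (c *\<^sub>R f) = c *\<^sub>R backward_shift f"
  by (simp_all add: fps_eq_iff flip: real_series_inject)

lemma subspace_z: "subspace z_real_hardy"
  by (auto simp: subspace_def z_real_hardy_iff)

lemma closed_z: "closed z_real_hardy"
  unfolding closed_sequential_limits
proof safe
  fix X f assume X: "\<forall>i. X i \<in> z_real_hardy" and lim: "X \<longlonglongrightarrow> f"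
  from tendsto_coeff[OF lim, of 0] X have "(\<lambda>i. 0) \<longlonglongrightarrow> fps_nth (real_series f) 0"
    by (simp add: z_real_hardy_iff)
  thus "f \<in> z_real_hardy" by (simp add: z_real_hardy_iff LIMSEQ_const_iff)
qed

locale nearly_invariant_subspace =
  fixes M :: "real_hardy set" and g :: real_hardy
  assumes subspace: "subspace M" and closed: "closed M" and nearly_invariant: "nearly_invariant M"
    and g_in: "g \<in> M" and norm_g: "norm g = 1" and g_0: "fps_nth (real_series g) 0 \<noteq> 0"
    and g_orth: "\<And>h. h \<in> M \<Longrightarrow> fps_nth (real_series h) 0 = 0 \<Longrightarrow> inner h g = 0"
begin

lemma inner_g_g [simp]: "inner g g = 1"
  using norm_g by (simp add: norm_eq_sqrt_inner)

text \<open>One step of the division by \<open>g\<close>: subtracting the component along \<open>g\<close> leaves an element of \<open>M\<close>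
that vanishes at \<open>0\<close>, and near invariance allows division by \<open>z\<close>. The constants removed in the
successive steps form the series \<open>quot f\<close>, which is \<open>f / g\<close>.\<close>

definition R :: "real_hardy \<Rightarrow> real_hardy" where
  "R f = backward_shift (f - inner f g *\<^sub>R g)"

definition quot :: "real_hardy \<Rightarrow> real fps" where
  "quot f = Abs_fps (\<lambda>k. inner ((R ^^ k) f) g)"

text \<open>Subtracting the multiple of \<open>g\<close> with the right value at \<open>0\<close> gives an element orthogonal to \<open>g\<close>, so
that multiple is the orthogonal projection onto \<open>g\<close>.\<close>

lemma remainder_nth_0:
  assumes "f \<in> M"
  shows "fps_nth (real_series (f - inner f g *\<^sub>R g)) 0 = 0"
proof -
  let ?c = "fps_nth (real_series f) 0 / fps_nth (real_series g) 0"
  have "inner (f - ?c *\<^sub>R g) g = 0"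
    using assms g_in g_0 subspace
    by (intro g_orth) (auto intro!: subspace_diff subspace_scale)
  thus ?thesis using g_0 by (simp add: inner_diff)
qed

lemma remainder_in: "f \<in> M \<Longrightarrow> f - inner f g *\<^sub>R g \<in> M"
  using g_in subspace by (intro subspace_diff subspace_scale)

lemma forward_shift_R: "f \<in> M \<Longrightarrow> forward_shift (R f) = f - inner f g *\<^sub>R g"
  unfolding R_def by (intro forward_shift_backward_shift remainder_nth_0)

lemma R_in: "f \<in> M \<Longrightarrow> R f \<in> M"
  unfolding R_def by (intro nearly_invariantD[OF nearly_invariant] remainder_in remainder_nth_0)

lemma R_funpow_in: "f \<in> M \<Longrightarrow> (R ^^ k) f \<in> M"
  by (induction k) (auto intro: R_in)

lemma R_add: "R (f + h) = R f + R h"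
proof -
  have "f + h - inner (f + h) g *\<^sub>R g = (f - inner f g *\<^sub>R g) + (h - inner h g *\<^sub>R g)"
    by (simp add: inner_add scaleR_left_distrib)
  thus ?thesis by (simp only: R_def backward_shift_add)
qed

lemma R_scaleR: "R (c *\<^sub>R f) = c *\<^sub>R R f"
proof -
  have "c *\<^sub>R f - inner (c *\<^sub>R f) g *\<^sub>R g = c *\<^sub>R (f - inner f g *\<^sub>R g)"
    by (simp add: scaleR_right_diff_distrib)
  thus ?thesis by (simp only: R_def backward_shift_scaleR)
qed

lemma linear_R_funpow: "linear (R ^^ k)"
  by (induction k) (auto intro!: linearI simp: R_add R_scaleR linear_add linear_scale)

lemma R_g [simp]: "R g = 0"
  by (simp add: R_def flip: real_series_inject)

lemma norm_R_sq:
  assumes "f \<in> M"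
  shows "(norm f)\<^sup>2 = (inner f g)\<^sup>2 + (norm (R f))\<^sup>2"
proof -
  have "(norm (R f))\<^sup>2 = (norm (f - inner f g *\<^sub>R g))\<^sup>2"
    using forward_shift_R[OF assms] norm_forward_shift[of "R f"] by simp
  also have "\<dots> = (norm f)\<^sup>2 - (inner f g)\<^sup>2"
    unfolding power2_norm_eq_inner
    by (simp add: inner_diff inner_commute power2_eq_square algebra_simps)
  finally show ?thesis by simp
qed

lemma norm_R_le: "f \<in> M \<Longrightarrow> norm (R f) \<le> norm f"
  by (rule power2_le_imp_le) (simp_all add: norm_R_sq)

lemma norm_R_funpow_le: "f \<in> M \<Longrightarrow> norm ((R ^^ k) f) \<le> norm f"
  using norm_R_le R_funpow_in by (induction k) (auto intro: order_trans)

text \<open>By this identity \<open>quot f\<close> is square summable, with norm at most that of \<open>f\<close>; equality of the norms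
amounts to \<open>R ^^ N\<close> tending to \<open>0\<close> at \<open>f\<close>.\<close>

lemma norm_sq_eq_sum_quot:
  assumes "f \<in> M"
  shows "(norm f)\<^sup>2 = (\<Sum>k<N. (fps_nth (quot f) k)\<^sup>2) + (norm ((R ^^ N) f))\<^sup>2"
  using norm_R_sq[OF R_funpow_in[OF assms]] by (induction N) (simp_all add: quot_def)

lemma quot_R_funpow: "quot ((R ^^ k) f) = fps_shift k (quot f)"
  by (simp add: quot_def fps_eq_iff funpow_add)

lemma ex_quot:
  assumes "f \<in> M"
  shows "\<exists>q. real_series q = quot f"
proof (rule summable_ex_real_series)
  show "(\<Sum>n<m. (fps_nth (quot f) n)\<^sup>2) \<le> (norm f)\<^sup>2" for m
    using norm_sq_eq_sum_quot[OF assms, of m] by simp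
qed

lemma real_series_eq_mult_quot:
  assumes "f \<in> M"
  shows "real_series f = real_series g * quot f"
proof -
  have "fps_nth (real_series f - real_series g * quot f) n = 0" for n
    using assms
  proof (induction n arbitrary: f)
    \<comment> \<open>the defect is \<open>z\<close> times the defect of \<open>R f\<close>, so its coefficients vanish one after the other\<close>
    have step: "real_series f - real_series g * quot f
        = fps_X * (real_series (R f) - real_series g * quot (R f))" if "f \<in> M" for f
    proof -
      have "fps_X * real_series (R f) = real_series f - fps_const (inner f g) * real_series g"
        using arg_cong[OF forward_shift_R[OF that], of real_series] by simp
      moreover have "quot f = fps_const (inner f g) + fps_X * quot (R f)"
        using quot_R_funpow[of 1 f]
        by (auto simp: fps_eq_iff quot_def gr0_conv_Suc)
      ultimately show ?thesis by (simp add: algebra_simps)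
    qed
    {
      case 0
      thus ?case by (subst step) auto
    next
      case (Suc n)
      thus ?case by (subst step) (auto simp: R_in)
    }
  qed
  thus ?thesis by (simp add: fps_eq_iff)
qed

section \<open>The adjoint of the compressed shift\<close>

text \<open>The compression to \<open>M\<close> of multiplication by \<open>z\<close>, with values projected to the elements vanishing at
\<open>0\<close>; on \<open>M\<close> it is the Hilbert space adjoint of \<open>R\<close>.\<close>

definition R_adj :: "real_hardy \<Rightarrow> real_hardy" where
  "R_adj f = (SOME p. p \<in> M \<inter> z_real_hardy \<and>
    (\<forall>s\<in>M \<inter> z_real_hardy. inner (forward_shift f - p) s = 0))"

lemma R_adj_props: "R_adj f \<in> M \<inter> z_real_hardy"
  "s \<in> M \<inter> z_real_hardy \<Longrightarrow> inner (forward_shift f - R_adj f) s = 0"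
proof -
  have "\<exists>p. p \<in> M \<inter> z_real_hardy \<and>
      (\<forall>s\<in>M \<inter> z_real_hardy. inner (forward_shift f - p) s = 0)"
    using ex_orthogonal_projection[of "M \<inter> z_real_hardy" "forward_shift f"]
      subspace closed subspace_z closed_z by (auto intro: subspace_inter closed_Int)
  from someI_ex[OF this] show "R_adj f \<in> M \<inter> z_real_hardy"
    "s \<in> M \<inter> z_real_hardy \<Longrightarrow> inner (forward_shift f - R_adj f) s = 0"
    unfolding R_adj_def by blast+
qed

lemma R_adj_in: "R_adj f \<in> M"
  using R_adj_props(1) by blast

lemma R_adj_funpow_in: "f \<in> M \<Longrightarrow> (R_adj ^^ k) f \<in> M"
  by (cases k) (auto intro: R_adj_in)

lemma inner_R_adj_g [simp]: "inner (R_adj f) g = 0" "inner g (R_adj f) = 0"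
  using R_adj_props(1)[of f] g_orth[of "R_adj f"] by (simp_all add: z_real_hardy_iff inner_commute[of g])

text \<open>As \<open>R_adj f\<close> is orthogonal to \<open>g\<close>, only the part \<open>z R f'\<close> of \<open>f'\<close> contributes; that part vanishes at \<open>0\<close> and
thus does not see the projection, and the shift is an isometry.\<close>

lemma inner_R_eq:
  assumes "f' \<in> M"
  shows "inner (R f') f = inner f' (R_adj f)"
proof -
  have "inner f' (R_adj f) = inner (f' - inner f' g *\<^sub>R g) (R_adj f)" by (simp add: inner_diff)
  also have "\<dots> = inner (forward_shift (R f')) (R_adj f)" by (simp add: forward_shift_R assms)
  also have "\<dots> = inner (forward_shift (R f')) (forward_shift f)"
    using R_adj_props(2)[of "forward_shift (R f')" f] remainder_in[OF assms] remainder_nth_0[OF assms]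
    by (simp add: forward_shift_R assms z_real_hardy_iff inner_diff inner_commute)
  finally show ?thesis by simp
qed

lemma inner_R_funpow_eq:
  assumes "f' \<in> M"
  shows "inner ((R ^^ k) f') f = inner f' ((R_adj ^^ k) f)"
  using assms
proof (induction k arbitrary: f)
  case (Suc k)
  thus ?case using inner_R_eq[OF R_funpow_in[OF Suc.prems]] by (simp add: funpow_swap1)
qed simp

text \<open>In the expansion of the square the mixed term is, by adjointness, the squared norm of \<open>R_adj v\<close>, and
the last term is at most that because \<open>R\<close> is a contraction. Thus \<open>I - R R*\<close> is controlled by the energy
that the adjoint loses.\<close>

lemma norm_diff_R_R_adj_sq_le:
  assumes "v \<in> M"
  shows "(norm (v - R (R_adj v)))\<^sup>2 \<le> (norm v)\<^sup>2 - (norm (R_adj v))\<^sup>2"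
proof -
  have "inner v (R (R_adj v)) = (norm (R_adj v))\<^sup>2"
    using inner_R_eq[OF R_adj_in, of v v] by (simp add: inner_commute power2_norm_eq_inner)
  moreover have "(norm (v - R (R_adj v)))\<^sup>2
      = (norm v)\<^sup>2 - 2 * inner v (R (R_adj v)) + (norm (R (R_adj v)))\<^sup>2"
    unfolding power2_norm_eq_inner by (simp add: inner_diff inner_commute)
  moreover have "(norm (R (R_adj v)))\<^sup>2 \<le> (norm (R_adj v))\<^sup>2"
    by (intro power_mono norm_R_le R_adj_in) simp
  ultimately show ?thesis by simp
qed

text \<open>The states of a discrete linear system driven by the inputs \<open>h\<close>. Pairing the states with \<open>f\<close> yields
the convolution of \<open>quot f\<close> with \<open>h\<close>, so that bounds on convolutions become energy estimates for the system.\<close>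

primrec state :: "real fps \<Rightarrow> nat \<Rightarrow> real_hardy" where
  "state h 0 = 0"
| "state h (Suc l) = fps_nth h l *\<^sub>R g + R_adj (state h l)"

lemma state_in: "state h l \<in> M"
  by (cases l) (use subspace g_in R_adj_in in \<open>auto intro: subspace_0 subspace_add subspace_scale\<close>)

lemma inner_state:
  assumes "f \<in> M"
  shows "inner f (state h (Suc l)) = fps_nth (quot f * h) l"
  using assms
proof (induction l arbitrary: f)
  case 0
  have "inner f (R_adj 0) = 0" using inner_R_eq[OF 0, of 0] by simp
  thus ?case by (simp add: inner_add quot_def)
next
  case (Suc l)
  have "inner f (state h (Suc (Suc l))) = fps_nth h (Suc l) * inner f g + inner (R f) (state h (Suc l))"
    by (simp only: state.simps(2)[of h "Suc l"] inner_add_right inner_scaleR_right inner_R_eq[OF Suc.prems])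
  also have "inner (R f) (state h (Suc l)) = fps_nth (quot (R f) * h) l"
    by (intro Suc.IH R_in Suc.prems)
  also have "quot (R f) = fps_shift 1 (quot f)" using quot_R_funpow[of 1 f] by simp
  also have "fps_nth h (Suc l) * inner f g + fps_nth (fps_shift 1 (quot f) * h) l
      = fps_nth (quot f * h) (Suc l)"
    unfolding fps_mult_nth sum.atLeast0_atMost_Suc_shift
    by (simp add: quot_def mult.commute)
  finally show ?case .
qed

lemma norm_state_sq: "(norm (state h (Suc l)))\<^sup>2 = (fps_nth h l)\<^sup>2 + (norm (R_adj (state h l)))\<^sup>2"
  unfolding power2_norm_eq_inner by (simp add: inner_add power2_eq_square)

text \<open>Energy balance: the input is orthogonal to the range of the adjoint, so the energy lost along the way
and the energy of the final state add up to the energy fed in.\<close>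

lemma sum_norm_state_le:
  "(\<Sum>l<N. (norm (state h l))\<^sup>2 - (norm (R_adj (state h l)))\<^sup>2) \<le> (\<Sum>l<N. (fps_nth h l)\<^sup>2)"
proof -
  have "(\<Sum>l<N. (norm (state h l))\<^sup>2 - (norm (R_adj (state h l)))\<^sup>2) + (norm (state h N))\<^sup>2
      = (\<Sum>l<N. (fps_nth h l)\<^sup>2)"
    by (induction N) (simp_all add: norm_state_sq del: state.simps(2))
  moreover have "(norm (state h N))\<^sup>2 \<ge> 0" by simp
  ultimately show ?thesis by linarith
qed

lemma conv_bounded_quot_iff:
  assumes "f \<in> M"
  shows "conv_bounded B (quot f) \<longleftrightarrow>
    (\<forall>h N. (\<Sum>l<N. (inner f (state h (Suc l)))\<^sup>2) \<le> B * (\<Sum>l<N. (fps_nth h l)\<^sup>2))"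
  unfolding conv_bounded_def inner_state[OF assms] ..

text \<open>The state before the last input is recovered from the next one by \<open>R\<close>, up to the error
\<open>u - R (R_adj u)\<close> with \<open>u\<close> the earlier state. Hence the output for \<open>R_adj f\<close> is the delayed output for
\<open>f\<close> plus errors whose total is bounded by the energy balance.\<close>

lemma conv_bounded_quot_R_adj:
  assumes f: "f \<in> M" and bdd: "conv_bounded B (quot f)"
  shows "conv_bounded (2 * B + 2 * (norm f)\<^sup>2) (quot (R_adj f))"
  unfolding conv_bounded_quot_iff[OF R_adj_in]
proof (intro allI)
  fix h N
  let ?u = "state h" and ?H = "\<Sum>l<N. (fps_nth h l)\<^sup>2"
  let ?d = "\<lambda>l. (norm (?u l))\<^sup>2 - (norm (R_adj (?u l)))\<^sup>2"
  have step: "(inner (R_adj f) (?u (Suc l)))\<^sup>2 \<le> 2 * (inner f (?u l))\<^sup>2 + 2 * ((norm f)\<^sup>2 * ?d l)" for l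
  proof -
    have "R (?u (Suc l)) = R (R_adj (?u l))" by (simp add: R_add R_scaleR)
    hence "inner (R_adj f) (?u (Suc l)) = inner f (?u l) - inner f (?u l - R (R_adj (?u l)))"
      using inner_R_eq[OF state_in, of h "Suc l" f] by (simp add: inner_diff inner_commute del: state.simps)
    also have "\<dots>\<^sup>2 \<le> 2 * (inner f (?u l))\<^sup>2 + 2 * (inner f (?u l - R (R_adj (?u l))))\<^sup>2"
      by (rule power2_diff_le)
    also have "(inner f (?u l - R (R_adj (?u l))))\<^sup>2 \<le> (norm f)\<^sup>2 * (norm (?u l - R (R_adj (?u l))))\<^sup>2"
      using Cauchy_Schwarz_ineq[of f "?u l - R (R_adj (?u l))"] by (simp only: power2_norm_eq_inner)
    also have "(norm f)\<^sup>2 * (norm (?u l - R (R_adj (?u l))))\<^sup>2 \<le> (norm f)\<^sup>2 * ?d l"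
      by (intro mult_left_mono norm_diff_R_R_adj_sq_le state_in) simp
    finally show ?thesis by simp
  qed
  have "(\<Sum>l<N. (inner f (?u l))\<^sup>2) \<le> (\<Sum>l<Suc N. (inner f (?u l))\<^sup>2)" by simp
  also have "\<dots> = (\<Sum>l<N. (inner f (?u (Suc l)))\<^sup>2)"
    by (simp add: sum.lessThan_Suc_shift del: sum.lessThan_Suc state.simps(2))
  also have "\<dots> \<le> B * ?H"
    using bdd unfolding conv_bounded_quot_iff[OF f] by blast
  finally have prev: "(\<Sum>l<N. (inner f (?u l))\<^sup>2) \<le> B * ?H" .
  have "(\<Sum>l<N. (inner (R_adj f) (?u (Suc l)))\<^sup>2)
      \<le> (\<Sum>l<N. 2 * (inner f (?u l))\<^sup>2 + 2 * ((norm f)\<^sup>2 * ?d l))"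
    by (intro sum_mono step)
  also have "\<dots> = 2 * (\<Sum>l<N. (inner f (?u l))\<^sup>2) + 2 * ((norm f)\<^sup>2 * (\<Sum>l<N. ?d l))"
    by (simp only: sum.distrib sum_distrib_left)
  also have "\<dots> \<le> 2 * (B * ?H) + 2 * ((norm f)\<^sup>2 * ?H)"
    by (intro add_mono mult_left_mono prev sum_norm_state_le) auto
  also have "\<dots> = (2 * B + 2 * (norm f)\<^sup>2) * ?H" by (simp add: algebra_simps)
  finally show "(\<Sum>l<N. (inner (R_adj f) (?u (Suc l)))\<^sup>2) \<le> (2 * B + 2 * (norm f)\<^sup>2) * ?H" .
qed

lemma conv_bounded_quot_g: "conv_bounded 1 (quot g)"
  unfolding conv_bounded_quot_iff[OF g_in] by (simp add: inner_add)

lemma conv_bounded_quot_R_adj_funpow_g: "\<exists>B. conv_bounded B (quot ((R_adj ^^ n) g))"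
proof (induction n)
  case 0
  show ?case using conv_bounded_quot_g by auto
next
  case (Suc n)
  thus ?case using conv_bounded_quot_R_adj[OF R_adj_funpow_in[OF g_in]] by auto
qed

section \<open>Strong stability\<close>

lemma R_funpow_R_adj_funpow_g_tendsto_0: "(\<lambda>k. (R ^^ k) ((R_adj ^^ n) g)) \<longlonglongrightarrow> 0"
proof -
  define f where "f = (R_adj ^^ n) g"
  have f: "f \<in> M" unfolding f_def by (intro R_adj_funpow_in g_in)
  obtain q where q: "real_series q = quot f" using ex_quot[OF f] by blast
  obtain B where "conv_bounded B (quot f)" using conv_bounded_quot_R_adj_funpow_g f_def by blast
  hence B: "conv_bounded B (real_series q)" by (simp add: q)
  have "(\<lambda>k. (R ^^ k) f) \<longlonglongrightarrow> 0"
    by (rule mult_backward_shift_tendsto_0[OF B])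
       (use f in \<open>auto simp: q R_funpow_in quot_R_funpow[symmetric] norm_R_le
         intro: real_series_eq_mult_quot\<close>)
  thus ?thesis by (simp add: f_def)
qed

text \<open>The elements of \<open>M\<close> at which the powers of the contraction \<open>R\<close> tend to \<open>0\<close> form a closed subspace
containing all \<open>(R_adj ^^ k) g\<close>. A vector \<open>f\<close> of \<open>M\<close> orthogonal to these has \<open>quot f = 0\<close>, and then
\<open>f = g * quot f = 0\<close>.\<close>

lemma R_funpow_tendsto_0:
  assumes x: "x \<in> M"
  shows "(\<lambda>k. (R ^^ k) x) \<longlonglongrightarrow> 0"
proof -
  define Z where "Z = {f \<in> M. (\<lambda>k. (R ^^ k) f) \<longlonglongrightarrow> 0}"
  have "subspace Z"
    unfolding Z_def
  proof (rule subspaceI)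
    show "0 \<in> {f \<in> M. (\<lambda>k. (R ^^ k) f) \<longlonglongrightarrow> 0}"
      using subspace by (simp add: subspace_0 linear_0[OF linear_R_funpow])
  next
    fix a b assume "a \<in> {f \<in> M. (\<lambda>k. (R ^^ k) f) \<longlonglongrightarrow> 0}" "b \<in> {f \<in> M. (\<lambda>k. (R ^^ k) f) \<longlonglongrightarrow> 0}"
    thus "a + b \<in> {f \<in> M. (\<lambda>k. (R ^^ k) f) \<longlonglongrightarrow> 0}"
      using subspace tendsto_add[of "\<lambda>k. (R ^^ k) a" 0 sequentially "\<lambda>k. (R ^^ k) b" 0]
      by (auto simp: linear_add[OF linear_R_funpow] intro: subspace_add)
  next
    fix c a assume "a \<in> {f \<in> M. (\<lambda>k. (R ^^ k) f) \<longlonglongrightarrow> 0}"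
    thus "c *\<^sub>R a \<in> {f \<in> M. (\<lambda>k. (R ^^ k) f) \<longlonglongrightarrow> 0}"
      using subspace tendsto_scaleR[OF tendsto_const, of "\<lambda>k. (R ^^ k) a" 0 sequentially c]
      by (auto simp: linear_scale[OF linear_R_funpow] intro: subspace_scale)
  qed
  moreover have "closed Z"
    unfolding closed_sequential_limits
  proof safe
    fix X f assume X: "\<forall>i. X i \<in> Z" and lim: "X \<longlonglongrightarrow> f"
    have XM: "X i \<in> M" for i using X by (auto simp: Z_def)
    have f: "f \<in> M" using closed_sequentially[OF closed] XM lim by blast
    have "(\<lambda>k. (R ^^ k) f) \<longlonglongrightarrow> 0"
    proof (rule LIMSEQ_I)
      fix e :: real assume e: "e > 0"
      obtain i where i: "norm (X i - f) < e / 2"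
        using LIMSEQ_D[OF lim, of "e/2"] e by auto
      obtain K where K: "\<And>k. k \<ge> K \<Longrightarrow> norm ((R ^^ k) (X i)) < e / 2"
        using X LIMSEQ_D[of "\<lambda>k. (R ^^ k) (X i)" 0 "e/2"] e by (auto simp: Z_def)
      have "norm ((R ^^ k) f - 0) < e" if "k \<ge> K" for k
      proof -
        have "(R ^^ k) f = (R ^^ k) (X i) - (R ^^ k) (X i - f)"
          by (simp add: linear_diff[OF linear_R_funpow])
        hence "norm ((R ^^ k) f) \<le> norm ((R ^^ k) (X i)) + norm ((R ^^ k) (X i - f))"
          by (simp only: norm_triangle_ineq4)
        also have "norm ((R ^^ k) (X i - f)) \<le> norm (X i - f)"
          using XM f subspace by (intro norm_R_funpow_le subspace_diff)
        finally show ?thesis using i K[OF that] by simp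
      qed
      thus "\<exists>no. \<forall>n\<ge>no. norm ((R ^^ n) f - 0) < e" by blast
    qed
    thus "f \<in> Z" using f by (simp add: Z_def)
  qed
  ultimately obtain p where p: "p \<in> Z" "\<And>s. s \<in> Z \<Longrightarrow> inner (x - p) s = 0"
    using ex_orthogonal_projection[of Z x] by blast
  have f: "x - p \<in> M" using x p(1) subspace by (auto simp: Z_def intro: subspace_diff)
  have "fps_nth (quot (x - p)) k = 0" for k
  proof -
    have "(R_adj ^^ k) g \<in> Z"
      using R_funpow_R_adj_funpow_g_tendsto_0 R_adj_funpow_in[OF g_in] by (simp add: Z_def)
    thus ?thesis using p(2) inner_R_funpow_eq[OF f, of k g] by (simp add: quot_def)
  qed
  hence "quot (x - p) = 0" by (simp add: fps_eq_iff)
  hence "x - p = 0"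
    using real_series_eq_mult_quot[OF f] by (simp flip: real_series_inject)
  thus ?thesis using p(1) by (simp add: Z_def)
qed

lemma norm_quot:
  assumes f: "f \<in> M" and q: "real_series q = quot f"
  shows "norm q = norm f"
proof -
  have "(\<lambda>N. (norm f)\<^sup>2 - (norm ((R ^^ N) f))\<^sup>2) \<longlonglongrightarrow> (norm f)\<^sup>2 - (norm (0::real_hardy))\<^sup>2"
    by (intro tendsto_intros R_funpow_tendsto_0 f)
  moreover have "(norm f)\<^sup>2 - (norm ((R ^^ N) f))\<^sup>2 = (\<Sum>k<N. (fps_nth (real_series q) k)\<^sup>2)" for N
    using norm_sq_eq_sum_quot[OF f, of N] by (simp add: q)
  ultimately have "(\<lambda>k. (fps_nth (real_series q) k)\<^sup>2) sums (norm f)\<^sup>2"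
    by (simp add: sums_def)
  hence "(norm q)\<^sup>2 = (norm f)\<^sup>2" using norm_sq_sums sums_unique2 by blast
  thus ?thesis by simp
qed

section \<open>The invariant subspace of quotients\<close>

lemma real_series_g_nonzero: "real_series g \<noteq> 0"
  using g_0 by auto

lemma norm_mult_g:
  assumes "h \<in> M" "real_series h = real_series g * real_series q"
  shows "norm h = norm q"
proof -
  have "real_series g * real_series q = real_series g * quot h"
    using assms real_series_eq_mult_quot by metis
  hence "real_series q = quot h" using real_series_g_nonzero by simp
  thus ?thesis using norm_quot assms(1) by simp
qed

definition N :: "real_hardy set" where
  "N = {q. \<exists>h\<in>M. real_series h = real_series g * real_series q}"

lemma subspace_N: "subspace N"
  unfolding N_def
proof (rule subspaceI)
  show "0 \<in> {q. \<exists>h\<in>M. real_series h = real_series g * real_series q}"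
    using subspace by (auto intro!: bexI[of _ 0] subspace_0)
next
  fix p q
  assume "p \<in> {q. \<exists>h\<in>M. real_series h = real_series g * real_series q}"
    "q \<in> {q. \<exists>h\<in>M. real_series h = real_series g * real_series q}"
  then obtain h k where "h \<in> M" "k \<in> M" "real_series h = real_series g * real_series p"
    "real_series k = real_series g * real_series q" by blast
  thus "p + q \<in> {q. \<exists>h\<in>M. real_series h = real_series g * real_series q}"
    using subspace by (auto intro!: bexI[of _ "h + k"] subspace_add simp: algebra_simps)
next
  fix c q
  assume "q \<in> {q. \<exists>h\<in>M. real_series h = real_series g * real_series q}"
  then obtain h where "h \<in> M" "real_series h = real_series g * real_series q" by blast
  thus "c *\<^sub>R q \<in> {q. \<exists>h\<in>M. real_series h = real_series g * real_series q}"
    using subspace by (auto intro!: bexI[of _ "c *\<^sub>R h"] subspace_scale simp: algebra_simps)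
qed

text \<open>Division by \<open>g\<close> is an isometry from \<open>M\<close> onto \<open>N\<close>, so completeness of \<open>M\<close> carries over.\<close>

lemma closed_N: "closed N"
  unfolding closed_sequential_limits
proof safe
  fix X q assume X: "\<forall>i. X i \<in> N" and lim: "X \<longlonglongrightarrow> q"
  then obtain H where H: "\<And>i. H i \<in> M" "\<And>i. real_series (H i) = real_series g * real_series (X i)"
    unfolding N_def by (auto simp: Bex_def dest!: choice)
  have "norm (H i - H j) = norm (X i - X j)" for i j
    using H subspace by (intro norm_mult_g subspace_diff) (auto simp: algebra_simps)
  hence "Cauchy H"
    using LIMSEQ_imp_Cauchy[OF lim] unfolding Cauchy_def dist_norm by simp
  then obtain h where h: "H \<longlonglongrightarrow> h" by (auto simp: Cauchy_convergent_iff convergent_def)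
  have "h \<in> M" using closed_sequentially[OF closed] H(1) h by blast
  moreover have "real_series h = real_series g * real_series q"
    unfolding fps_eq_iff
  proof
    fix n
    have "(\<lambda>i. fps_nth (real_series g * real_series (X i)) n)
        \<longlonglongrightarrow> fps_nth (real_series g * real_series q) n"
      unfolding fps_mult_nth by (intro tendsto_intros tendsto_coeff lim)
    thus "fps_nth (real_series h) n = fps_nth (real_series g * real_series q) n"
      using tendsto_coeff[OF h, of n] unfolding H(2) by (rule LIMSEQ_unique[rotated])
  qed
  ultimately show "q \<in> N" by (auto simp: N_def)
qed

lemma backward_shift_N: "backward_shift ` N \<subseteq> N"
proof safe
  fix q assume "q \<in> N"
  then obtain h where h: "h \<in> M" "real_series h = real_series g * real_series q"
    by (auto simp: N_def)
  hence "real_series q = quot h"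
    using real_series_eq_mult_quot[OF h(1)] real_series_g_nonzero by simp
  hence "real_series (R h) = real_series g * real_series (backward_shift q)"
    using real_series_eq_mult_quot[OF R_in[OF h(1)]] quot_R_funpow[of 1 h] by simp
  thus "backward_shift q \<in> N" using R_in[OF h(1)] by (auto simp: N_def)
qed

lemma image_series_eq: "series ` M = {series g * series f | f. f \<in> N}"
proof safe
  fix h assume h: "h \<in> M"
  then obtain q where "real_series q = quot h" using ex_quot by blast
  hence q: "real_series h = real_series g * real_series q"
    using real_series_eq_mult_quot[OF h] by simp
  hence "q \<in> N" using h by (auto simp: N_def)
  thus "\<exists>f. series h = series g * series f \<and> f \<in> N"
    using q by (auto simp: real_series_mult_iff)
next
  fix f assume "f \<in> N"
  then obtain h where "h \<in> M" "real_series h = real_series g * real_series f"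
    by (auto simp: N_def)
  thus "series g * series f \<in> series ` M"
    unfolding real_series_mult_iff[symmetric] by (metis imageI)
qed

end

section \<open>Existence of the generating function\<close>

text \<open>If every element of \<open>M\<close> vanished at \<open>0\<close>, then near invariance would be full invariance under the
backward shift, and all coefficients of all elements would vanish.\<close>

lemma ex_nonzero_nth_0:
  assumes "subspace M" "M \<noteq> {0}" "nearly_invariant M"
  shows "\<exists>f\<in>M. fps_nth (real_series f) 0 \<noteq> 0"
proof (rule ccontr)
  assume *: "\<not> ?thesis"
  have "(backward_shift ^^ k) f \<in> M" if "f \<in> M" for f k
    using that * by (induction k) (auto intro: nearly_invariantD[OF assms(3)])
  hence "fps_nth (real_series f) k = 0" if "f \<in> M" for f k
    using * that real_series_funpow_backward_shift[of k f] by force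
  hence "f = 0" if "f \<in> M" for f
    using that by (simp add: fps_eq_iff flip: real_series_inject)
  thus False using assms(1,2) subspace_0 by blast
qed

lemma ex_generator:
  assumes M: "subspace M" "closed M" "M \<noteq> {0}" "nearly_invariant M"
  shows "\<exists>g. nearly_invariant_subspace M g \<and> fps_nth (real_series g) 0 > 0"
proof -
  obtain f where f: "f \<in> M" "fps_nth (real_series f) 0 \<noteq> 0"
    using ex_nonzero_nth_0[OF M(1,3,4)] by blast
  \<comment> \<open>the sign makes the value at \<open>0\<close> positive; subtracting an element vanishing at \<open>0\<close> and normalising preserve this\<close>
  define e where "e = sgn (fps_nth (real_series f) 0) *\<^sub>R f"
  have e: "e \<in> M" "fps_nth (real_series e) 0 > 0"
    using f M(1) by (auto simp: e_def sgn_if intro: subspace_scale subspace_neg)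
  have "subspace (M \<inter> z_real_hardy)" "closed (M \<inter> z_real_hardy)"
    using M by (auto intro: subspace_inter closed_Int subspace_z closed_z)
  then obtain p where p: "p \<in> M \<inter> z_real_hardy" "\<And>s. s \<in> M \<inter> z_real_hardy \<Longrightarrow> inner (e - p) s = 0"
    using ex_orthogonal_projection by blast
  define g where "g = (1 / norm (e - p)) *\<^sub>R (e - p)"
  have pos: "fps_nth (real_series (e - p)) 0 > 0" using e p(1) by (simp add: z_real_hardy_iff)
  hence ne: "e - p \<noteq> 0" by (metis fps_zero_nth less_irrefl real_series_0)
  have "nearly_invariant_subspace M g"
  proof
    show "g \<in> M" using e p(1) M(1) by (auto simp: g_def intro!: subspace_scale subspace_diff)
    show "norm g = 1" using ne by (simp add: g_def)
    show "fps_nth (real_series g) 0 \<noteq> 0" using pos ne by (simp add: g_def)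
    show "inner h g = 0" if "h \<in> M" "fps_nth (real_series h) 0 = 0" for h
      using p(2)[of h] that by (simp add: g_def z_real_hardy_iff inner_commute)
  qed (use M in auto)
  moreover have "fps_nth (real_series g) 0 > 0"
    using pos ne by (simp add: g_def)
  ultimately show ?thesis by blast
qed

theorem theorem3p4:
  fixes M :: "real_hardy set"
  assumes "subspace M" and "closed M" and "M \<noteq> {0}"
    and "nearly_invariant M"
  shows "\<exists>(N :: real_hardy set) (g :: real_hardy).
    subspace N \<and> closed N \<and> backward_shift ` N \<subseteq> N \<and>
    g \<in> M \<and> (\<forall>h \<in> M \<inter> z_real_hardy. orthogonal g h) \<and> Re (eval_fps (series g) 0) > 0 \<and>
    series ` M = {series g * series f | f. f \<in> N} \<and>
    (\<forall>f\<in>N. \<forall>h\<in>M. series h = series g * series f \<longrightarrow> norm h = norm f)"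
proof -
  obtain g where "nearly_invariant_subspace M g" and g_pos: "fps_nth (real_series g) 0 > 0"
    using ex_generator[OF assms] by blast
  then interpret nearly_invariant_subspace M g by blast
  have "\<forall>h \<in> M \<inter> z_real_hardy. orthogonal g h"
    using g_orth by (auto simp: orthogonal_def z_real_hardy_iff inner_commute)
  moreover have "Re (eval_fps (series g) 0) > 0"
    using g_pos by (simp add: eval_fps_series_0 del: of_real_real_series)
  moreover have "\<forall>f\<in>N. \<forall>h\<in>M. series h = series g * series f \<longrightarrow> norm h = norm f"
    using norm_mult_g by (auto simp: real_series_mult_iff)
  ultimately show ?thesis
    using subspace_N closed_N backward_shift_N g_in image_series_eq by blast
qed

end
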